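(* Let $k\in\mathbb{N}$ and $\ell\in\{1,2,4,5\}$, and let $S=\langle 3,\ 6k+\ell\rangle$. Then $O(S)=(3k+\ell)(k+1)$.
   Context: $\mathbb{N}=\{0,1,2,\dots\}$. A numerical semigroup is a subset of $\mathbb{N}$ that contains $0$, has finite complement in $\mathbb{N}$, and is closed under addition. $\langle n_1,\dots,n_t\rangle=\{\sum_i a_i n_i : a_i\in\mathbb{N}\}$. For a numerical semigroup $S$, $O(S)$ is the number of oversemigroups of $S$, i.e. the number of numerical semigroups $T$ with $T\supseteq S$ (including $T=S$ and $T=\mathbb{N}$). *)

theory Defs
  imports Main
begin

definition numerical_semigroup :: "nat set \<Rightarrow> bool" where
  "numerical_semigroup S \<longleftrightarrow>
     0 \<in> S \<and> finite (- S) \<and> (\<forall>x\<in>S. \<forall>y\<in>S. x + y \<in> S)"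

definition generated :: "nat list \<Rightarrow> nat set" where
  "generated ns = {(\<Sum>i<length ns. a i * ns ! i) | a :: nat \<Rightarrow> nat. True}"

definition oversemigroups :: "nat set \<Rightarrow> nat set set" where
  "oversemigroups S = {T. numerical_semigroup T \<and> S \<subseteq> T}"

text \<open>For a numerical semigroup S the complement of S is finite, so \<open>oversemigroups S\<close>
  is finite and its \<open>card\<close> is the genuine number of elements.\<close>

definition num_oversemigroups :: "nat set \<Rightarrow> nat" where
  "num_oversemigroups S = card (oversemigroups S)"

end

theory Submission
  imports Defs
begin

text \<open>A numerical semigroup containing 3 is determined by its least elements \<open>3 * x + 1\<close> and
  \<open>3 * y + 2\<close> in the two nonzero residue classes modulo 3, and closure under addition amounts to
  \<open>y \<le> 2 * x\<close> and \<open>x \<le> 2 * y + 1\<close>. Such a semigroup contains \<open>\<langle>3, n\<rangle>\<close> iff it contains \<open>n\<close>, which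
  is the upper bound \<open>n div 3\<close> on \<open>x\<close> or on \<open>y\<close>; so the oversemigroups are the lattice points of
  a triangle.\<close>

text \<open>\<open>x\<close> and \<open>y\<close> are the Kunz coordinates with respect to 3.
  Closure under addition is not built in, so it can become a condition on the pair.\<close>

definition residue_semigroup :: "nat \<Rightarrow> nat \<Rightarrow> nat set" where
  "residue_semigroup x y =
     {t. t mod 3 = 0 \<or> t mod 3 = 1 \<and> 3 * x + 1 \<le> t \<or> t mod 3 = 2 \<and> 3 * y + 2 \<le> t}"

lemma mem_residue_semigroup [simp]:
  "3 * q \<in> residue_semigroup x y"
  "3 * q + 1 \<in> residue_semigroup x y \<longleftrightarrow> x \<le> q"
  "3 * q + 2 \<in> residue_semigroup x y \<longleftrightarrow> y \<le> q"
proof -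
  have "(3 * q + 1) mod 3 = 1" "(3 * q + 2) mod 3 = 2"
    by presburger+
  then show "3 * q \<in> residue_semigroup x y"
    and "3 * q + 1 \<in> residue_semigroup x y \<longleftrightarrow> x \<le> q"
    and "3 * q + 2 \<in> residue_semigroup x y \<longleftrightarrow> y \<le> q"
    by (simp_all only: residue_semigroup_def mem_Collect_eq) simp_all
qed

lemma mod3_cases:
  fixes t :: nat
  obtains q where "t = 3 * q" | q where "t = 3 * q + 1" | q where "t = 3 * q + 2"
proof -
  have "t = 3 * (t div 3) \<or> t = 3 * (t div 3) + 1 \<or> t = 3 * (t div 3) + 2"
    by presburger
  then show thesis
    using that by blast
qed

text \<open>Doubling the least element of one nonzero class gives an element of the other class, and
  each doubling yields one inequality. No other sums constrain: mixed sums are multiples of 3, and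
  adding a multiple of 3 stays in the class without decreasing.\<close>

lemma numerical_semigroup_residue_semigroup:
  "numerical_semigroup (residue_semigroup x y) \<longleftrightarrow> y \<le> 2 * x \<and> x \<le> 2 * y + 1"
proof
  assume S: "numerical_semigroup (residue_semigroup x y)"
  have "3 * x + 1 \<in> residue_semigroup x y" "3 * y + 2 \<in> residue_semigroup x y"
    by (simp_all only: mem_residue_semigroup order_refl)
  then have "(3 * x + 1) + (3 * x + 1) \<in> residue_semigroup x y"
    and "(3 * y + 2) + (3 * y + 2) \<in> residue_semigroup x y"
    using S unfolding numerical_semigroup_def by blast+
  moreover have "(3 * x + 1) + (3 * x + 1) = 3 * (2 * x) + 2"
    and "(3 * y + 2) + (3 * y + 2) = 3 * (2 * y + 1) + 1"
    by simp_all
  ultimately show "y \<le> 2 * x \<and> x \<le> 2 * y + 1"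
    by (simp only: mem_residue_semigroup)
next
  assume xy: "y \<le> 2 * x \<and> x \<le> 2 * y + 1"
  have sums: "3 * q + 3 * r = 3 * (q + r)"
    "3 * q + (3 * r + 1) = 3 * (q + r) + 1" "(3 * q + 1) + 3 * r = 3 * (q + r) + 1"
    "3 * q + (3 * r + 2) = 3 * (q + r) + 2" "(3 * q + 2) + 3 * r = 3 * (q + r) + 2"
    "(3 * q + 1) + (3 * r + 1) = 3 * (q + r) + 2"
    "(3 * q + 2) + (3 * r + 2) = 3 * (q + r + 1) + 1"
    "(3 * q + 1) + (3 * r + 2) = 3 * (q + r + 1)"
    "(3 * q + 2) + (3 * r + 1) = 3 * (q + r + 1)" for q r :: nat
    by simp_all
  have "s + t \<in> residue_semigroup x y"
    if "s \<in> residue_semigroup x y" "t \<in> residue_semigroup x y" for s t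
    using that xy
    by (cases s rule: mod3_cases; cases t rule: mod3_cases;
        simp only: sums mem_residue_semigroup; linarith?)
  moreover have "finite (- residue_semigroup x y)"
    \<comment> \<open>A crude bound that dominates both \<open>3 * x + 1\<close> and
      \<open>3 * y + 2\<close>.\<close>
    by (rule finite_subset[of _ "{..<3 * x + 3 * y + 2}"])
      (auto simp: residue_semigroup_def not_le)
  ultimately show "numerical_semigroup (residue_semigroup x y)"
    unfolding numerical_semigroup_def by (auto simp: residue_semigroup_def)
qed

text \<open>Each coordinate is the membership threshold of its class, so the set determines it;
  counting semigroups thus becomes counting pairs.\<close>

lemma inj_residue_semigroup: "inj (case_prod residue_semigroup)"
proof (rule injI, clarsimp)
  fix x y x' y'
  assume eq: "residue_semigroup x y = residue_semigroup x' y'"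
  have "x \<le> q \<longleftrightarrow> x' \<le> q" "y \<le> q \<longleftrightarrow> y' \<le> q" for q
    using eq mem_residue_semigroup(2,3) by metis+
  then show "x = x' \<and> y = y'"
    by (meson order_antisym order_refl)
qed

lemma add_mult_mem:
  assumes "numerical_semigroup T" and "s \<in> T" and "t \<in> T"
  shows "s + a * t \<in> T"
proof (induction a)
  case (Suc a)
  then have "(s + a * t) + t \<in> T"
    using assms unfolding numerical_semigroup_def by blast
  then show ?case
    by (simp add: ac_simps)
qed (simp add: assms)

text \<open>Cofiniteness makes \<open>T\<close> meet the class, and adding 3 repeatedly makes the
  intersection upward closed, so \<open>m\<close> is its least quotient.\<close>

lemma residue_class_eq:
  assumes T: "numerical_semigroup T" and "3 \<in> T"
  obtains m where "\<And>q. 3 * q + r \<in> T \<longleftrightarrow> m \<le> q"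
proof
  have "finite ((\<lambda>q. 3 * q + r) -` (- T))"
    using T by (intro finite_vimageI) (auto simp: numerical_semigroup_def inj_on_def)
  then obtain p where "3 * p + r \<in> T"
    using ex_new_if_finite[OF infinite_UNIV_nat] by auto
  then have m: "3 * (LEAST q. 3 * q + r \<in> T) + r \<in> T"
    by (rule LeastI)
  fix q
  show "3 * q + r \<in> T \<longleftrightarrow> (LEAST q. 3 * q + r \<in> T) \<le> q"
  proof
    assume "(LEAST q. 3 * q + r \<in> T) \<le> q"
    then obtain d where "q = (LEAST q. 3 * q + r \<in> T) + d"
      using le_Suc_ex by blast
    then show "3 * q + r \<in> T"
      using add_mult_mem[OF T m \<open>3 \<in> T\<close>, of d] by (simp add: algebra_simps)
  qed (rule Least_le)
qed

lemma eq_residue_semigroup: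
  assumes T: "numerical_semigroup T" and "3 \<in> T"
  obtains x y where "T = residue_semigroup x y"
proof -
  obtain x where x: "\<And>q. 3 * q + 1 \<in> T \<longleftrightarrow> x \<le> q"
    using residue_class_eq[OF assms] by blast
  obtain y where y: "\<And>q. 3 * q + 2 \<in> T \<longleftrightarrow> y \<le> q"
    using residue_class_eq[OF assms] by blast
  have "0 \<in> T"
    using T by (simp add: numerical_semigroup_def)
  then have z: "3 * q \<in> T" for q
    using add_mult_mem[OF T _ \<open>3 \<in> T\<close>, of 0 q] by (simp add: mult.commute)
  have "t \<in> T \<longleftrightarrow> t \<in> residue_semigroup x y" for t
    by (cases t rule: mod3_cases) (simp_all only: x y z mem_residue_semigroup)
  then show thesis
    using that by blast
qed

lemma generated_pair: "generated [m, n] = {a * m + b * n | a b. True}"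
proof -
  have "\<exists>c :: nat \<Rightarrow> nat. a * m + b * n = c 0 * m + c (Suc 0) * n" for a b
    by (rule exI[of _ "\<lambda>i. if i = 0 then a else b"]) simp
  then show ?thesis
    unfolding generated_def by auto
qed

lemma generated_pair_subset_iff:
  assumes T: "numerical_semigroup T"
  shows "generated [m, n] \<subseteq> T \<longleftrightarrow> m \<in> T \<and> n \<in> T"
proof
  have "m = 1 * m + 0 * n" "n = 0 * m + 1 * n"
    by simp_all
  then have "m \<in> generated [m, n]" "n \<in> generated [m, n]"
    unfolding generated_pair by blast+
  then show "m \<in> T \<and> n \<in> T" if "generated [m, n] \<subseteq> T"
    using that by blast
next
  assume mn: "m \<in> T \<and> n \<in> T"
  have "0 \<in> T"
    using T by (simp add: numerical_semigroup_def)
  then have "0 + a * m + b * n \<in> T" for a b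
    using mn by (intro add_mult_mem[OF T]) auto
  then show "generated [m, n] \<subseteq> T"
    unfolding generated_pair by auto
qed

lemma num_oversemigroups_3:
  "num_oversemigroups (generated [3, n]) =
     card {(x, y). y \<le> 2 * x \<and> x \<le> 2 * y + 1 \<and> n \<in> residue_semigroup x y}"
proof -
  have "3 \<in> residue_semigroup x y" for x y
    by (simp add: residue_semigroup_def)
  then have mem: "residue_semigroup x y \<in> oversemigroups (generated [3, n]) \<longleftrightarrow>
      y \<le> 2 * x \<and> x \<le> 2 * y + 1 \<and> n \<in> residue_semigroup x y" for x y
    unfolding oversemigroups_def mem_Collect_eq numerical_semigroup_residue_semigroup[symmetric]
      conj_assoc[symmetric]
    by (metis generated_pair_subset_iff)
  have "\<exists>x y. T = residue_semigroup x y" if "T \<in> oversemigroups (generated [3, n])" for T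
    using that unfolding oversemigroups_def
    by (metis eq_residue_semigroup generated_pair_subset_iff mem_Collect_eq)
  then have "oversemigroups (generated [3, n]) = case_prod residue_semigroup `
      {(x, y). residue_semigroup x y \<in> oversemigroups (generated [3, n])}"
    by fast
  then show ?thesis
    unfolding num_oversemigroups_def mem
    by (simp add: card_image inj_on_subset[OF inj_residue_semigroup])
qed

text \<open>Membership of \<open>3 * m + 1\<close> bounds only \<open>x\<close>, so the points are
  counted by columns: \<open>x \<le> 2 * y + 1\<close> is the same as
  \<open>x div 2 \<le> y\<close>.\<close>

lemma num_oversemigroups_3_mod_1:
  "num_oversemigroups (generated [3, 3 * m + 1]) = (\<Sum>x\<le>m. Suc (2 * x) - x div 2)"
proof -
  have "{(x, y). y \<le> 2 * x \<and> x \<le> 2 * y + 1 \<and> 3 * m + 1 \<in> residue_semigroup x y}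
      = Sigma {..m} (\<lambda>x. {x div 2..2 * x})"
    unfolding mem_residue_semigroup by auto
  then show ?thesis
    unfolding num_oversemigroups_3 by simp
qed

lemma num_oversemigroups_3_mod_2:
  "num_oversemigroups (generated [3, 3 * m + 2]) = (\<Sum>y\<le>m. Suc (2 * y + 1) - (y + 1) div 2)"
proof -
  have "{(x, y). y \<le> 2 * x \<and> x \<le> 2 * y + 1 \<and> 3 * m + 2 \<in> residue_semigroup x y}
      = prod.swap ` Sigma {..m} (\<lambda>y. {(y + 1) div 2..2 * y + 1})"
    unfolding mem_residue_semigroup by (auto simp: image_iff)
  then show ?thesis
    unfolding num_oversemigroups_3 by (simp add: card_image)
qed

text \<open>Fixing the parity of the upper limit tames the floor: raising \<open>k\<close> by one
  adds two consecutive summands, and each is linear in \<open>k\<close>.\<close>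

lemma sum_mod_1:
  "(\<Sum>x\<le>2 * k. Suc (2 * x) - x div 2) = (3 * k + 1) * (k + 1)"
  "(\<Sum>x\<le>2 * k + 1. Suc (2 * x) - x div 2) = (3 * k + 4) * (k + 1)"
  by (induction k) (simp_all add: algebra_simps)

lemma sum_mod_2:
  "(\<Sum>y\<le>2 * k. Suc (2 * y + 1) - (y + 1) div 2) = (3 * k + 2) * (k + 1)"
  "(\<Sum>y\<le>2 * k + 1. Suc (2 * y + 1) - (y + 1) div 2) = (3 * k + 5) * (k + 1)"
  by (induction k) (simp_all add: algebra_simps)

theorem theorem1p7:
  fixes k l :: nat and S :: "nat set"
  assumes "l \<in> {1, 2, 4, 5}"
    and "S = generated [3, 6 * k + l]"
  shows "num_oversemigroups S = (3 * k + l) * (k + 1)"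
proof -
  \<comment> \<open>The residue of \<open>l\<close> modulo 3 selects the sum; whether
    \<open>l\<close> exceeds 3 selects the parity of its upper limit.\<close>
  have n: "6 * k + 1 = 3 * (2 * k) + 1" "6 * k + 2 = 3 * (2 * k) + 2"
    "6 * k + 4 = 3 * (2 * k + 1) + 1" "6 * k + 5 = 3 * (2 * k + 1) + 2"
    by simp_all
  from assms(1) consider "l = 1" | "l = 2" | "l = 4" | "l = 5"
    by blast
  then show ?thesis
    by cases (simp_all only: assms(2) n num_oversemigroups_3_mod_1 num_oversemigroups_3_mod_2
        sum_mod_1 sum_mod_2)
qed

end
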